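(* For every integer $n\ge 10$ and every vertex $v\in V(CF_n)$: if $n$ is odd then $f_p(CF_n,v)=3\lfloor n/2\rfloor$, and if $n$ is even then $f_p(CF_n,v)=\frac{3n}{2}-1$.
   Context: The cuttlefish graph $CF_n$ ($n\ge 3$): start with a cycle on vertices $u_1,\dots,u_n$ with edges $u_iu_{i+1}$ (indices mod $n$). Add new vertices $v_1,\dots,v_{\lfloor n/2\rfloor-1}$ and $w_1,\dots,w_{\lfloor n/2\rfloor-1}$ with edges $u_1v_1$, $v_iv_{i+1}$ and $u_2w_1$, $w_iw_{i+1}$ for $1\le i\le\lfloor n/2\rfloor-2$ (two pendant paths of length $\lfloor n/2\rfloor-1$ attached at $u_1$ and $u_2$). The \emph{path variant of the Explorer–Director game} on a finite connected graph $G$ with starting vertex $v$: a token starts on $v$. In each round, with the token on $u$, the Explorer names a positive integer $l$ such that $G$ contains a path (no repeated vertices) of length $l$ starting at $u$, and the Director moves the token to any vertex $w$ such that $G$ contains a $uw$ path of length $l$. Visited vertices are those the token has ever occupied (including $v$). The Explorer maximizes and the Director minimizes the number of visited vertices; the game ends when the Director can keep the token on visited vertices indefinitely; $f_p(G,v)$ is the final number of visited vertices under optimal play. *)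

theory Defs
  imports "Graph_Theory.Pair_Digraph" "Graph_Theory.Vertex_Walk"
begin

(* Undirected simple graphs are the symmetric loop-free digraphs of Graph_Theory
   (locale pair_graph): an edge {x, y} is the pair of arcs (x, y), (y, x). *)

datatype cf_vertex = U nat | V nat | W nat

(* The condition on U 1 - V 1 and U 2 - W 1 only matters for n = 3, where the pendant
   paths are empty. *)
definition cuttlefish_edges :: "nat \<Rightarrow> cf_vertex rel" where
  "cuttlefish_edges n =
     {(U i, U (i mod n + 1)) | i. 1 \<le> i \<and> i \<le> n}
     \<union> (if 1 \<le> n div 2 - 1 then {(U 1, V 1), (U 2, W 1)} else {})
     \<union> {(V i, V (i + 1)) | i. 1 \<le> i \<and> i + 1 \<le> n div 2 - 1}
     \<union> {(W i, W (i + 1)) | i. 1 \<le> i \<and> i + 1 \<le> n div 2 - 1}"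

definition cuttlefish :: "nat \<Rightarrow> cf_vertex pair_pre_digraph" where
  "cuttlefish n =
     \<lparr> pverts = U ` {1..n} \<union> V ` {1..n div 2 - 1} \<union> W ` {1..n div 2 - 1},
       parcs = cuttlefish_edges n \<union> (cuttlefish_edges n)\<inverse> \<rparr>"

lemma cuttlefish_pair_graph: "3 \<le> n \<Longrightarrow> pair_graph (cuttlefish n)"
proof -
  assume n: "3 \<le> n"
  have mod_bound: "i mod n + 1 \<le> n" for i
    using n mod_less_divisor[of n i] by linarith
  have no_fix: "i mod n + 1 \<noteq> i" if "1 \<le> i" "i \<le> n" for i
    using n that by (cases "i = n") auto
  have wf: "parcs (cuttlefish n) \<subseteq> pverts (cuttlefish n) \<times> pverts (cuttlefish n)"
    using n mod_bound by (auto simp: cuttlefish_def cuttlefish_edges_def)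
  moreover have fin: "finite (pverts (cuttlefish n))"
    by (simp add: cuttlefish_def)
  ultimately have "finite (parcs (cuttlefish n))"
    by (meson finite_SigmaI finite_subset)
  moreover have "fst e \<noteq> snd e" if "e \<in> parcs (cuttlefish n)" for e
    using that no_fix by (fastforce simp: cuttlefish_def cuttlefish_edges_def split: if_splits)
  moreover have "symmetric (with_proj (cuttlefish n))"
    by (auto simp: symmetric_def cuttlefish_def intro!: symI)
  ultimately show ?thesis
    using wf fin by unfold_locales auto
qed

definition path_of_length :: "('a, 'b) pre_digraph \<Rightarrow> 'a \<Rightarrow> nat \<Rightarrow> 'a \<Rightarrow> bool" where
  "path_of_length G u l w \<longleftrightarrow>
     (\<exists>p. vpath p G \<and> hd p = u \<and> last p = w \<and> vwalk_length p = l)"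

definition may_name :: "('a, 'b) pre_digraph \<Rightarrow> 'a \<Rightarrow> nat \<Rightarrow> bool" where
  "may_name G u l \<longleftrightarrow> 0 < l \<and> (\<exists>w. path_of_length G u l w)"

coinductive director_can_stay :: "('a, 'b) pre_digraph \<Rightarrow> 'a set \<Rightarrow> 'a \<Rightarrow> bool"
  for G :: "('a, 'b) pre_digraph" and S :: "'a set" where
  "u \<in> S \<Longrightarrow>
   (\<forall>l. may_name G u l \<longrightarrow> (\<exists>w. path_of_length G u l w \<and> director_can_stay G S w)) \<Longrightarrow>
   director_can_stay G S u"

(* A history lists the completed rounds in order: the length named by the Explorer
   and the vertex chosen by the Director. *)
type_synonym 'a history = "(nat \<times> 'a) list"

type_synonym 'a explorer_strategy = "'a history \<Rightarrow> nat"

type_synonym 'a director_strategy = "'a history \<Rightarrow> nat \<Rightarrow> 'a"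

definition token :: "'a \<Rightarrow> 'a history \<Rightarrow> 'a" where
  "token v h = (if h = [] then v else snd (last h))"

definition visited :: "'a \<Rightarrow> 'a history \<Rightarrow> 'a set" where
  "visited v h = insert v (snd ` set h)"

definition legal_explorer ::
  "('a, 'b) pre_digraph \<Rightarrow> 'a \<Rightarrow> 'a explorer_strategy \<Rightarrow> bool" where
  "legal_explorer G v \<sigma> \<longleftrightarrow>
     (\<forall>h. token v h \<in> verts G \<longrightarrow> may_name G (token v h) (\<sigma> h))"

definition legal_director ::
  "('a, 'b) pre_digraph \<Rightarrow> 'a \<Rightarrow> 'a director_strategy \<Rightarrow> bool" where
  "legal_director G v \<tau> \<longleftrightarrow>
     (\<forall>h l. may_name G (token v h) l \<longrightarrow> path_of_length G (token v h) l (\<tau> h l))"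

primrec play :: "'a explorer_strategy \<Rightarrow> 'a director_strategy \<Rightarrow> nat \<Rightarrow> 'a history" where
  "play \<sigma> \<tau> 0 = []"
| "play \<sigma> \<tau> (Suc t) =
     (let h = play \<sigma> \<tau> t; l = \<sigma> h in h @ [(l, \<tau> h l)])"

definition game_over :: "('a, 'b) pre_digraph \<Rightarrow> 'a \<Rightarrow> 'a history \<Rightarrow> bool" where
  "game_over G v h \<longleftrightarrow> director_can_stay G (visited v h) (token v h)"

(* A play between badly chosen strategies may never reach the end of the game; its
   score is then the number of vertices visited over all rounds. *)
definition final_visited ::
  "('a, 'b) pre_digraph \<Rightarrow> 'a \<Rightarrow> 'a explorer_strategy \<Rightarrow> 'a director_strategy \<Rightarrow> nat" where
  "final_visited G v \<sigma> \<tau> =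
     (if \<exists>t. game_over G v (play \<sigma> \<tau> t)
      then card (visited v (play \<sigma> \<tau> (LEAST t. game_over G v (play \<sigma> \<tau> t))))
      else card (\<Union>t. visited v (play \<sigma> \<tau> t)))"

(* Intended for finite connected graphs with at least two vertices: every score is then
   at most the number of vertices and legal strategies exist, so that the SUP and INF
   over nat are a maximum and a minimum. *)
definition f_p :: "('a, 'b) pre_digraph \<Rightarrow> 'a \<Rightarrow> nat" where
  "f_p G v =
     (SUP \<sigma> \<in> {\<sigma>. legal_explorer G v \<sigma>}.
        INF \<tau> \<in> {\<tau>. legal_director G v \<tau>}. final_visited G v \<sigma> \<tau>)"

end

theory Submission
  imports Defs
begin

text \<open>Call a set of vertices closed if from each of its members every nameable length can be answered
  inside the set. The Director can confine the token to a closed set containing the start, and the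
  Explorer can always force the visited set to contain a closed one. Writing \<open>k = n div 2\<close>, the
  minimal closed sets of the cuttlefish graph have \<open>n + k - 1\<close> vertices.

  The set of all tail vertices and \<open>U 1, \<dots>, U (n + 1 - k)\<close> is closed, because a walk downwards
  around the cycle either skips the missing arc or can turn into the tail at \<open>U 1\<close> instead; together
  with its image under the reflection exchanging the two tails it covers the graph.

  Conversely, a closed set meets a tail (name \<open>n\<close>, if necessary after naming \<open>1\<close>), hence contains
  both leaves (name the length of a longest path), hence both tails with \<open>U 1\<close> and \<open>U 2\<close> (name the
  lengths below \<open>k\<close> at the leaves). Longer names at the leaf \<open>V (k - 1)\<close> put one of \<open>U i, U j\<close> into
  the set whenever \<open>i + j = n + 2\<close>, and those at \<open>W (k - 1)\<close> do so whenever \<open>i + j = n + 4\<close>, for \<open>i\<close> in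
  the upper half of the cycle. Each family is one vertex short of the bound. The missing vertex is
  \<open>U n\<close> or \<open>U 3\<close> if the set contains one of these; otherwise \<open>U (n - 1)\<close> and \<open>U 4\<close> belong to it,
  naming \<open>1\<close> at \<open>U 4\<close> gives \<open>U 5\<close>, and the pair \<open>U 5, U (n - 1)\<close> of the second family is contained
  in it entirely.\<close>

section \<open>Closed sets and the value of the game\<close>

text \<open>A function on \<open>{..l}\<close> instead of a list: subpaths become index shifts,
  images under a graph map become compositions, and concrete paths can be given by formulas.\<close>

definition indexed_path :: "('a, 'b) pre_digraph \<Rightarrow> (nat \<Rightarrow> 'a) \<Rightarrow> nat \<Rightarrow> bool" where
  "indexed_path G f l \<longleftrightarrow>
     (\<forall>t\<le>l. f t \<in> verts G) \<and> (\<forall>t<l. (f t, f (Suc t)) \<in> arcs_ends G) \<and> inj_on f {..l}"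

lemma set_vwalk_arcs: "set (vwalk_arcs p) = {(p ! i, p ! Suc i) | i. Suc i < length p}"
proof (induction p rule: vwalk_arcs.induct)
  case (3 x y xs)
  have "{((x # y # xs) ! i, (x # y # xs) ! Suc i) | i. Suc i < length (x # y # xs)}
    = insert (x, y) {((y # xs) ! i, (y # xs) ! Suc i) | i. Suc i < length (y # xs)}"
    (is "?A = insert _ ?B")
  proof
    show "?A \<subseteq> insert (x, y) ?B"
    proof
      fix e assume "e \<in> ?A"
      then obtain i where i: "Suc i < length (x # y # xs)"
        "e = ((x # y # xs) ! i, (x # y # xs) ! Suc i)" by blast
      then show "e \<in> insert (x, y) ?B" by (cases i) auto
    qed
    show "insert (x, y) ?B \<subseteq> ?A"
    proof
      fix e assume "e \<in> insert (x, y) ?B"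
      then consider "e = (x, y)"
        | i where "Suc i < length (y # xs)" "e = ((y # xs) ! i, (y # xs) ! Suc i)" by blast
      then show "e \<in> ?A"
      proof cases
        case 1 then show ?thesis by (intro CollectI exI[of _ 0]) simp
      next
        case 2 then show ?thesis by (intro CollectI exI[of _ "Suc i"]) simp
      qed
    qed
  qed
  then show ?case using 3 by simp
qed auto

lemma path_of_length_iff_indexed_path:
  "path_of_length G u l w \<longleftrightarrow> (\<exists>f. indexed_path G f l \<and> f 0 = u \<and> f l = w)"
proof
  assume "path_of_length G u l w"
  then obtain p where p: "set p \<subseteq> verts G" "set (vwalk_arcs p) \<subseteq> arcs_ends G" "p \<noteq> []"
    "distinct p" "hd p = u" "last p = w" "length p - 1 = l"
    by (auto simp: path_of_length_def vpath_def vwalk_def)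
  have len: "length p = Suc l" using p by (cases p) auto
  have "indexed_path G ((!) p) l"
    unfolding indexed_path_def
  proof (intro conjI allI impI)
    show "p ! t \<in> verts G" if "t \<le> l" for t using p(1) len that by (auto simp: subset_iff)
    show "(p ! t, p ! Suc t) \<in> arcs_ends G" if "t < l" for t
      using p(2) len that by (auto simp: set_vwalk_arcs)
    show "inj_on ((!) p) {..l}" using p(4) len by (intro inj_on_nth) auto
  qed
  moreover have "p ! 0 = u" "p ! l = w" using p len by (auto simp: hd_conv_nth last_conv_nth)
  ultimately show "\<exists>f. indexed_path G f l \<and> f 0 = u \<and> f l = w" by blast
next
  assume "\<exists>f. indexed_path G f l \<and> f 0 = u \<and> f l = w"
  then obtain f where f: "indexed_path G f l" "f 0 = u" "f l = w" by blast
  define p where "p = map f [0..<Suc l]"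
  have "vpath p G"
    unfolding vpath_def vwalk_def
  proof (intro conjI)
    show "set p \<subseteq> verts G" using f(1) by (auto simp: p_def indexed_path_def)
    show "set (vwalk_arcs p) \<subseteq> arcs_ends G"
      using f(1) by (auto simp: p_def indexed_path_def set_vwalk_arcs simp del: upt_Suc)
    show "p \<noteq> []" by (simp add: p_def)
    have "set [0..<Suc l] = {..l}" by auto
    then show "distinct p" using f(1) unfolding p_def indexed_path_def distinct_map by simp
  qed
  moreover have "hd p = u" "last p = w" "vwalk_length p = l"
    using f by (auto simp: p_def hd_map simp del: upt_Suc) (simp_all add: hd_conv_nth last_map)
  ultimately show "path_of_length G u l w" unfolding path_of_length_def by blast
qed

lemma path_of_length_target_in_verts: "path_of_length G u l w \<Longrightarrow> w \<in> verts G"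
  by (auto simp: path_of_length_iff_indexed_path indexed_path_def)

section \<open>Closed sets and escape from a set\<close>

definition closed_position_set :: "('a, 'b) pre_digraph \<Rightarrow> 'a set \<Rightarrow> bool" where
  "closed_position_set G S \<longleftrightarrow>
     (\<forall>u\<in>S. \<forall>l. may_name G u l \<longrightarrow> (\<exists>w\<in>S. path_of_length G u l w))"

text \<open>A member of \<open>S\<close> outside the graph has no nameable length and so satisfies
  \<open>director_can_stay\<close> vacuously; intersecting with \<open>verts G\<close> removes such
  members.\<close>

lemma closed_positions_director_can_stay:
  "closed_position_set G ({w. director_can_stay G S w} \<inter> verts G)"
  unfolding closed_position_set_def
  by (blast elim: director_can_stay.cases dest: path_of_length_target_in_verts)

text \<open>The attractor of \<open>- S\<close> by stages: from stage \<open>i\<close> the Explorer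
  can force the token out of \<open>S\<close> within \<open>i\<close> rounds.\<close>

primrec escape :: "('a, 'b) pre_digraph \<Rightarrow> 'a set \<Rightarrow> nat \<Rightarrow> 'a set" where
  "escape G S 0 = - S"
| "escape G S (Suc i) =
     escape G S i \<union> {u. \<exists>l. may_name G u l \<and> (\<forall>w. path_of_length G u l w \<longrightarrow> w \<in> escape G S i)}"

lemma escape_mono: "i \<le> j \<Longrightarrow> escape G S i \<subseteq> escape G S j"
  by (induction j) (auto simp: le_Suc_eq)

text \<open>Coinduction on the complement of all stages. If every answer to some name lay in a
  stage, finiteness would give one stage containing them all, and the position itself would lie in
  the next.\<close>

lemma director_can_stay_if_no_escape:
  assumes "finite (verts G)" and "\<forall>i. u \<notin> escape G S i"
  shows "director_can_stay G S u"
  using assms(2)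
proof (coinduction arbitrary: u)
  case director_can_stay
  have "\<exists>w. path_of_length G u l w \<and> (\<forall>i. w \<notin> escape G S i)" if l: "may_name G u l" for l
  proof (rule ccontr)
    assume "\<nexists>w. path_of_length G u l w \<and> (\<forall>i. w \<notin> escape G S i)"
    then obtain r where r: "\<And>w. path_of_length G u l w \<Longrightarrow> w \<in> escape G S (r w)" by metis
    have "w \<in> escape G S (Max (r ` verts G))" if "path_of_length G u l w" for w
    proof -
      have "r w \<le> Max (r ` verts G)"
        using assms(1) path_of_length_target_in_verts[OF that] by simp
      then show ?thesis using r[OF that] escape_mono[of "r w" "Max (r ` verts G)" G S] by auto
    qed
    then have "u \<in> escape G S (Suc (Max (r ` verts G)))" using l by auto
    then show False using director_can_stay by blast
  qed
  moreover have "u \<in> S" using spec[OF director_can_stay, of 0] by simp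
  ultimately show ?case by blast
qed

definition escape_rank :: "('a, 'b) pre_digraph \<Rightarrow> 'a set \<Rightarrow> 'a \<Rightarrow> nat" where
  "escape_rank G S u = (LEAST i. u \<in> escape G S i)"

text \<open>The least stage containing \<open>u\<close> is not the initial one, as \<open>u\<close>
  is in \<open>S\<close>; the name that put \<open>u\<close> there admits only answers from the
  stage before.\<close>

lemma escape_rank_decreasing_name:
  assumes "finite (verts G)" "u \<in> S" "\<not> director_can_stay G S u"
  shows "\<exists>l. may_name G u l \<and>
    (\<forall>w. path_of_length G u l w \<longrightarrow> w \<in> S \<longrightarrow> escape_rank G S w < escape_rank G S u)"
proof -
  let ?r = "escape_rank G S u"
  obtain i where "u \<in> escape G S i" using director_can_stay_if_no_escape[OF assms(1), of u S] assms(3) by auto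
  then have r: "u \<in> escape G S ?r" unfolding escape_rank_def by (rule LeastI)
  obtain j where j: "?r = Suc j" using r assms(2) by (cases ?r) auto
  have "u \<notin> escape G S j" using not_less_Least[of j "\<lambda>i. u \<in> escape G S i"] j
    by (simp add: escape_rank_def)
  then obtain l where l: "may_name G u l" "\<forall>w. path_of_length G u l w \<longrightarrow> w \<in> escape G S j"
    using r j by auto
  have "escape_rank G S w < ?r" if "path_of_length G u l w" for w
    using l(2) that j Least_le[of "\<lambda>i. w \<in> escape G S i" j] by (auto simp: escape_rank_def)
  then show ?thesis using l(1) by blast
qed

section \<open>Plays and strategies\<close>

lemma token_append [simp]: "token v (h @ [(l, w)]) = w"
  by (simp add: token_def)

lemma visited_append [simp]: "visited v (h @ [(l, w)]) = insert w (visited v h)"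
  by (auto simp: visited_def)

lemma token_in_visited: "token v h \<in> visited v h"
  by (auto simp: token_def visited_def)

lemma play_Suc_visited:
  "visited v (play \<sigma> \<tau> (Suc t)) = insert (token v (play \<sigma> \<tau> (Suc t))) (visited v (play \<sigma> \<tau> t))"
  by (simp add: Let_def)

lemma legal_play:
  assumes "v \<in> verts G" "legal_explorer G v \<sigma>" "legal_director G v \<tau>"
  shows "visited v (play \<sigma> \<tau> t) \<subseteq> verts G"
    and "path_of_length G (token v (play \<sigma> \<tau> t)) (\<sigma> (play \<sigma> \<tau> t)) (token v (play \<sigma> \<tau> (Suc t)))"
proof -
  have step: "path_of_length G (token v (play \<sigma> \<tau> t)) (\<sigma> (play \<sigma> \<tau> t)) (token v (play \<sigma> \<tau> (Suc t)))"
    if "token v (play \<sigma> \<tau> t) \<in> verts G" for t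
    using assms that by (auto simp: legal_explorer_def legal_director_def Let_def)
  have inv: "visited v (play \<sigma> \<tau> t) \<subseteq> verts G" for t
  proof (induction t)
    case 0 then show ?case using assms(1) by (simp add: visited_def)
  next
    case (Suc t)
    then have "token v (play \<sigma> \<tau> t) \<in> verts G" using token_in_visited by fastforce
    then show ?case
      unfolding play_Suc_visited using path_of_length_target_in_verts[OF step] Suc by blast
  qed
  show "visited v (play \<sigma> \<tau> t) \<subseteq> verts G" by (rule inv)
  show "path_of_length G (token v (play \<sigma> \<tau> t)) (\<sigma> (play \<sigma> \<tau> t)) (token v (play \<sigma> \<tau> (Suc t)))"
    using step inv token_in_visited by fastforce
qed

text \<open>The Explorer names a length that lowers the escape rank for the current visited set
  whenever the Director answers inside it. A round thus enlarges the visited set or keeps it and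
  lowers the rank, and this lexicographic measure is well founded.\<close>

lemma explorer_forces_game_over:
  fixes G :: "('a, 'b) pre_digraph"
  assumes fin: "finite (verts G)" and v: "v \<in> verts G"
    and mobile: "\<And>u. u \<in> verts G \<Longrightarrow> \<exists>l. may_name G u l"
  obtains \<sigma> where "legal_explorer G v \<sigma>"
    and "\<And>\<tau>. legal_director G v \<tau> \<Longrightarrow> \<exists>t. game_over G v (play \<sigma> \<tau> t)"
proof -
  let ?rank = "\<lambda>h. escape_rank G (visited v h) (token v h)"
  let ?good = "\<lambda>h l. may_name G (token v h) l \<and>
    (\<not> game_over G v h \<longrightarrow> (\<forall>w. path_of_length G (token v h) l w \<longrightarrow> w \<in> visited v h \<longrightarrow>
       escape_rank G (visited v h) w < ?rank h))"
  have "\<exists>l. ?good h l" if "token v h \<in> verts G" for h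
    using escape_rank_decreasing_name[OF fin token_in_visited] mobile[OF that]
    by (cases "game_over G v h") (auto simp: game_over_def)
  then obtain \<sigma> where \<sigma>: "\<And>h. token v h \<in> verts G \<Longrightarrow> ?good h (\<sigma> h)" by metis
  have legal: "legal_explorer G v \<sigma>" using \<sigma> by (auto simp: legal_explorer_def)
  have "\<exists>t. game_over G v (play \<sigma> \<tau> t)" if \<tau>: "legal_director G v \<tau>" for \<tau>
  proof (rule ccontr)
    assume never: "\<nexists>t. game_over G v (play \<sigma> \<tau> t)"
    let ?h = "play \<sigma> \<tau>"
    let ?m = "\<lambda>t. (card (verts G - visited v (?h t)), ?rank (?h t))"
    have "(?m (Suc t), ?m t) \<in> less_than <*lex*> less_than" for t
    proof (cases "token v (?h (Suc t)) \<in> visited v (?h t)")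
      case True
      then have same: "visited v (?h (Suc t)) = visited v (?h t)"
        unfolding play_Suc_visited by blast
      have "token v (?h t) \<in> verts G"
        using legal_play(1)[OF v legal \<tau>] token_in_visited by fastforce
      then have "escape_rank G (visited v (?h t)) (token v (?h (Suc t))) < ?rank (?h t)"
        using \<sigma> never legal_play(2)[OF v legal \<tau>] True by blast
      then show ?thesis using same by simp
    next
      case False
      have "token v (?h (Suc t)) \<in> verts G"
        using legal_play(1)[OF v legal \<tau>] token_in_visited by fastforce
      then have "verts G - visited v (?h (Suc t)) \<subset> verts G - visited v (?h t)"
        unfolding play_Suc_visited using False by blast
      then show ?thesis using fin by (simp add: psubset_card_mono)
    qed
    then show False
      using wf_no_infinite_down_chainE[OF wf_lex_prod[OF wf_less_than wf_less_than], where f = ?m]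
      by blast
  qed
  then show thesis using legal that by blast
qed

lemma director_stays_in_closed_set:
  assumes "closed_position_set G S" "v \<in> S" "S \<subseteq> verts G"
  obtains \<tau> where "legal_director G v \<tau>"
    and "\<And>\<sigma> t. legal_explorer G v \<sigma> \<Longrightarrow> visited v (play \<sigma> \<tau> t) \<subseteq> S"
proof -
  \<comment> \<open>A legal strategy must also answer histories whose token lies outside
    \<open>S\<close>; staying in \<open>S\<close> is required only from inside.\<close>
  have "\<exists>w. (may_name G (token v h) l \<longrightarrow> path_of_length G (token v h) l w) \<and>
      (may_name G (token v h) l \<longrightarrow> token v h \<in> S \<longrightarrow> w \<in> S)" for h l
    using assms(1) unfolding closed_position_set_def may_name_def by metis
  then obtain \<tau> where \<tau>: "\<And>h l. may_name G (token v h) l \<Longrightarrow> path_of_length G (token v h) l (\<tau> h l)"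
    "\<And>h l. may_name G (token v h) l \<Longrightarrow> token v h \<in> S \<Longrightarrow> \<tau> h l \<in> S" by metis
  have "visited v (play \<sigma> \<tau> t) \<subseteq> S" if \<sigma>: "legal_explorer G v \<sigma>" for \<sigma> t
  proof (induction t)
    case 0 then show ?case using assms(2) by (simp add: visited_def)
  next
    case (Suc t)
    have "token v (play \<sigma> \<tau> t) \<in> S" using Suc token_in_visited by fastforce
    moreover from this have "may_name G (token v (play \<sigma> \<tau> t)) (\<sigma> (play \<sigma> \<tau> t))"
      using \<sigma> assms(3) by (auto simp: legal_explorer_def)
    ultimately show ?case using Suc \<tau>(2) by (simp add: Let_def)
  qed
  moreover have "legal_director G v \<tau>" using \<tau>(1) by (simp add: legal_director_def)
  ultimately show thesis using that by blast
qed

text \<open>When the game is over, the vertices from which the Director can stay inside the visited set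
  form a closed set; so the Explorer forces as many visits as the smallest closed set has elements.\<close>

theorem f_p_eq_card_closed_set:
  assumes fin: "finite (verts G)"
    and mobile: "\<And>u. u \<in> verts G \<Longrightarrow> \<exists>l. may_name G u l"
    and S: "closed_position_set G S" "v \<in> S" "S \<subseteq> verts G"
    and minimal: "\<And>T. T \<subseteq> verts G \<Longrightarrow> T \<noteq> {} \<Longrightarrow> closed_position_set G T \<Longrightarrow> card S \<le> card T"
  shows "f_p G v = card S"
proof -
  have v: "v \<in> verts G" using S by blast
  let ?E = "{\<sigma>. legal_explorer G v \<sigma>}" and ?D = "{\<tau>. legal_director G v \<tau>}"
  let ?val = "\<lambda>\<sigma>. INF \<tau> \<in> ?D. final_visited G v \<sigma> \<tau>"
  obtain \<tau>\<^sub>0 where \<tau>\<^sub>0: "legal_director G v \<tau>\<^sub>0"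
    "\<And>\<sigma> t. legal_explorer G v \<sigma> \<Longrightarrow> visited v (play \<sigma> \<tau>\<^sub>0 t) \<subseteq> S"
    using director_stays_in_closed_set[OF S] by blast
  obtain \<sigma>\<^sub>0 where \<sigma>\<^sub>0: "legal_explorer G v \<sigma>\<^sub>0"
    "\<And>\<tau>. legal_director G v \<tau> \<Longrightarrow> \<exists>t. game_over G v (play \<sigma>\<^sub>0 \<tau> t)"
    using explorer_forces_game_over[OF fin v mobile] by blast
  have finS: "finite S" using S(3) fin finite_subset by blast
  have upper: "?val \<sigma> \<le> card S" if "\<sigma> \<in> ?E" for \<sigma>
  proof -
    have "?val \<sigma> \<le> final_visited G v \<sigma> \<tau>\<^sub>0" using \<tau>\<^sub>0(1) by (intro cINF_lower) auto
    also have "\<dots> \<le> card S"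
      unfolding final_visited_def using that \<tau>\<^sub>0(2) by (auto intro!: card_mono[OF finS] simp: UN_subset_iff)
    finally show ?thesis .
  qed
  have "card S \<le> final_visited G v \<sigma>\<^sub>0 \<tau>" if \<tau>: "\<tau> \<in> ?D" for \<tau>
  proof -
    let ?over = "\<lambda>t. game_over G v (play \<sigma>\<^sub>0 \<tau> t)"
    let ?h = "play \<sigma>\<^sub>0 \<tau> (LEAST t. ?over t)"
    have ex: "\<exists>t. ?over t" using \<sigma>\<^sub>0(2) \<tau> by blast
    then have "game_over G v ?h" by (rule LeastI_ex)
    moreover have vis: "visited v ?h \<subseteq> verts G" using legal_play(1)[OF v \<sigma>\<^sub>0(1)] \<tau> by blast
    moreover have "token v ?h \<in> visited v ?h" by (rule token_in_visited)
    \<comment> \<open>The token of the finished play makes this closed set nonempty, so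
      \<open>minimal\<close> applies.\<close>
    ultimately have "card S \<le> card ({w. director_can_stay G (visited v ?h) w} \<inter> verts G)"
      by (intro minimal closed_positions_director_can_stay) (auto simp: game_over_def)
    also have "\<dots> \<le> card (visited v ?h)"
      using vis fin by (intro card_mono) (auto elim: director_can_stay.cases dest: finite_subset)
    finally show ?thesis using ex by (simp add: final_visited_def)
  qed
  then have lower: "card S \<le> ?val \<sigma>\<^sub>0" using \<tau>\<^sub>0(1) by (intro cINF_greatest) auto
  have "f_p G v \<le> card S"
    unfolding f_p_def using \<sigma>\<^sub>0(1) upper by (intro cSUP_least) auto
  moreover have "?val \<sigma>\<^sub>0 \<le> f_p G v"
    unfolding f_p_def using \<sigma>\<^sub>0(1) upper by (intro cSUP_upper bdd_aboveI2) auto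
  ultimately show ?thesis using lower by linarith
qed

section \<open>Indexed paths\<close>

text \<open>Allows each concrete path to be written down once at full length; other starting points
  and lengths are read off as subpaths.\<close>

lemma indexed_path_subpath:
  assumes "indexed_path G f L" "i \<le> j" "j \<le> L"
  shows "path_of_length G (f i) (j - i) (f j)"
proof -
  have "inj_on (\<lambda>t. f (i + t)) {..j - i}"
    using assms by (intro comp_inj_on[where f = "\<lambda>t. i + t" and g = f, unfolded comp_def])
      (auto simp: indexed_path_def intro: inj_on_subset)
  then have "indexed_path G (\<lambda>t. f (i + t)) (j - i)"
    using assms by (auto simp: indexed_path_def)
  then show ?thesis using assms(2) by (auto simp: path_of_length_iff_indexed_path)
qed

text \<open>Here \<open>c\<close> is a cut vertex: entering \<open>T\<close> uses up
  \<open>c\<close>, leaving \<open>T\<close> would need it again, so a path that enters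
  \<open>T\<close> cannot end outside.\<close>

lemma indexed_path_avoids:
  assumes path: "indexed_path G f l" and "c \<notin> T" "f 0 \<notin> T" "f l \<notin> T"
    and cut: "\<And>x y. (x, y) \<in> arcs_ends G \<Longrightarrow> x \<in> T \<Longrightarrow> y \<notin> T \<Longrightarrow> y = c"
      "\<And>x y. (x, y) \<in> arcs_ends G \<Longrightarrow> x \<notin> T \<Longrightarrow> y \<in> T \<Longrightarrow> x = c"
    and "t \<le> l"
  shows "f t \<notin> T"
proof
  assume t: "f t \<in> T"
  define s where "s = (LEAST t. f t \<in> T)"
  have s: "f s \<in> T" "s \<le> t" unfolding s_def using t by (auto intro: LeastI Least_le)
  obtain r where r: "s = Suc r" using s(1) assms(3) by (cases s) auto
  have "f r \<notin> T" using r not_less_Least[of r "\<lambda>t. f t \<in> T"] by (simp add: s_def)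
  moreover have "(f r, f s) \<in> arcs_ends G" using path r s(2) \<open>t \<le> l\<close> by (auto simp: indexed_path_def)
  ultimately have c: "f r = c" using cut(2) s(1) by blast
  have "f q \<in> T" if "s \<le> q" "q \<le> l" for q
    using that
  proof (induction q rule: dec_induct)
    case base then show ?case using s by simp
  next
    case (step q)
    have "(f q, f (Suc q)) \<in> arcs_ends G" using path step by (auto simp: indexed_path_def)
    moreover have "f (Suc q) \<noteq> f r"
      using path step r by (auto simp: indexed_path_def dest: inj_onD)
    ultimately show ?case using cut(1) step c by force
  qed
  then show False using assms(4) s(2) \<open>t \<le> l\<close> by auto
qed

lemma indexed_path_length_less_card:
  assumes "indexed_path G f l" "\<And>t. t \<le> l \<Longrightarrow> f t \<in> X" "finite X"
  shows "l < card X"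
proof -
  have "card {..l} \<le> card X"
    using assms by (intro card_inj_on_le[of f]) (auto simp: indexed_path_def)
  then show ?thesis by simp
qed

text \<open>Choosing from each pair \<open>{i, c - i}\<close> a member of \<open>R\<close> is
  injective: \<open>c < 2 * a\<close> puts every \<open>c - i\<close> below \<open>a\<close>, and
  \<open>b \<le> c\<close> keeps the subtraction untruncated.\<close>

lemma card_ge_pairs:
  fixes R :: "nat set"
  assumes "finite R" "\<And>i. a \<le> i \<Longrightarrow> i \<le> b \<Longrightarrow> i \<in> R \<or> c - i \<in> R" "c < 2 * a" "b \<le> c"
  shows "Suc b - a \<le> card R"
proof -
  let ?g = "\<lambda>i. if i \<in> R then i else c - i"
  have "inj_on ?g {a..b}"
    by (rule inj_onI) (use assms(3,4) in \<open>auto split: if_splits\<close>)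
  then have "card {a..b} \<le> card R"
    using assms(1,2) by (intro card_inj_on_le[of ?g]) (auto, blast)
  then show ?thesis by simp
qed

section \<open>The cuttlefish graph\<close>

locale large_cuttlefish =
  fixes n k :: nat
  assumes n_ge: "10 \<le> n" and k_eq: "k = n div 2"
begin

lemma nk: "2 * k \<le> n" "n \<le> Suc (2 * k)" "5 \<le> k"
  using n_ge k_eq by auto

abbreviation G :: "(cf_vertex, cf_vertex \<times> cf_vertex) pre_digraph" where
  "G \<equiv> with_proj (cuttlefish n)"

section \<open>Adjacency and the reflection\<close>

definition adj :: "cf_vertex \<Rightarrow> cf_vertex \<Rightarrow> bool" where
  "adj x y \<longleftrightarrow> (x, y) \<in> parcs (cuttlefish n)"

lemma adj_simps [simp]:
  "adj (U i) (U j) \<longleftrightarrow> 1 \<le> i \<and> i \<le> n \<and> 1 \<le> j \<and> j \<le> n \<and>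
     (j = Suc i \<or> i = Suc j \<or> (i = n \<and> j = 1) \<or> (i = 1 \<and> j = n))"
  "adj (U i) (V j) \<longleftrightarrow> i = 1 \<and> j = 1"
  "adj (V j) (U i) \<longleftrightarrow> i = 1 \<and> j = 1"
  "adj (U i) (W j) \<longleftrightarrow> i = 2 \<and> j = 1"
  "adj (W j) (U i) \<longleftrightarrow> i = 2 \<and> j = 1"
  "adj (V i) (V j) \<longleftrightarrow> 1 \<le> i \<and> i < k \<and> 1 \<le> j \<and> j < k \<and> (j = Suc i \<or> i = Suc j)"
  "adj (W i) (W j) \<longleftrightarrow> 1 \<le> i \<and> i < k \<and> 1 \<le> j \<and> j < k \<and> (j = Suc i \<or> i = Suc j)"
  "\<not> adj (V i) (W j)"
  "\<not> adj (W i) (V j)"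
proof -
  show "adj (U i) (U j) \<longleftrightarrow> 1 \<le> i \<and> i \<le> n \<and> 1 \<le> j \<and> j \<le> n \<and>
     (j = Suc i \<or> i = Suc j \<or> (i = n \<and> j = 1) \<or> (i = 1 \<and> j = n))"
  proof -
    have "(U i, U j) \<in> cuttlefish_edges n \<longleftrightarrow>
      1 \<le> i \<and> i \<le> n \<and> (if i = n then j = 1 else j = Suc i)" for i j
      unfolding cuttlefish_edges_def by (auto split: if_splits)
    then show ?thesis using n_ge by (auto simp: adj_def cuttlefish_def)
  qed
qed (use nk in \<open>auto simp: adj_def cuttlefish_def cuttlefish_edges_def k_eq[symmetric]\<close>)

lemma in_verts [simp]:
  "U i \<in> pverts (cuttlefish n) \<longleftrightarrow> 1 \<le> i \<and> i \<le> n"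
  "V i \<in> pverts (cuttlefish n) \<longleftrightarrow> 1 \<le> i \<and> i < k"
  "W i \<in> pverts (cuttlefish n) \<longleftrightarrow> 1 \<le> i \<and> i < k"
  using nk by (auto simp: cuttlefish_def k_eq[symmetric])

lemma finite_verts: "finite (pverts (cuttlefish n))"
  by (simp add: cuttlefish_def)

lemma indexed_path_iff:
  "indexed_path G f l \<longleftrightarrow>
     (\<forall>t\<le>l. f t \<in> pverts (cuttlefish n)) \<and> (\<forall>t<l. adj (f t) (f (Suc t))) \<and> inj_on f {..l}"
  by (simp add: indexed_path_def adj_def)

lemma adj_sym: "adj x y \<longleftrightarrow> adj y x"
  by (auto simp: adj_def cuttlefish_def)

lemma adj_verts: "adj x y \<Longrightarrow> x \<in> pverts (cuttlefish n)"
  using nk by (cases x; cases y) auto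

abbreviation path :: "cf_vertex \<Rightarrow> nat \<Rightarrow> cf_vertex \<Rightarrow> bool" where
  "path \<equiv> path_of_length G"

lemma path_edge: "path u 1 w \<longleftrightarrow> adj u w"
proof
  assume "path u 1 w"
  then show "adj u w" by (auto simp: path_of_length_iff_indexed_path indexed_path_iff)
next
  assume uw: "adj u w"
  have "u \<noteq> w" using uw n_ge by (cases u; cases w) auto
  then have "indexed_path G (\<lambda>t. if t = 0 then u else w) 1"
    using uw adj_verts[OF uw] adj_verts[of w u] adj_sym
    by (auto simp: indexed_path_iff inj_on_def)
  then show "path u 1 w" unfolding path_of_length_iff_indexed_path by force
qed

text \<open>The reflection of the cycle that sends the index \<open>i\<close> to
  \<open>3 - i\<close> modulo \<open>n\<close>, with representatives in \<open>1..n\<close>. It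
  exchanges \<open>U 1\<close> and \<open>U 2\<close>, and the tails with them.\<close>

definition mirror :: "cf_vertex \<Rightarrow> cf_vertex" where
  "mirror x = (case x of U i \<Rightarrow> U (if i \<le> 2 then 3 - i else n + 3 - i) | V i \<Rightarrow> W i | W i \<Rightarrow> V i)"

lemma mirror_simps [simp]:
  "mirror (V i) = W i" "mirror (W i) = V i"
  "mirror (U i) = U (if i \<le> 2 then 3 - i else n + 3 - i)"
  by (simp_all add: mirror_def)

lemma mirror_mirror: "x \<in> pverts (cuttlefish n) \<Longrightarrow> mirror (mirror x) = x"
  by (cases x) auto

lemma mirror_verts: "x \<in> pverts (cuttlefish n) \<Longrightarrow> mirror x \<in> pverts (cuttlefish n)"
  using n_ge by (cases x) auto

lemma inj_on_mirror: "inj_on mirror (pverts (cuttlefish n))"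
  by (rule inj_on_inverseI[of _ mirror]) (rule mirror_mirror)

lemma adj_mirror: "adj x y \<Longrightarrow> adj (mirror x) (mirror y)"
  using n_ge by (cases x; cases y) auto

lemma path_mirror: "path u l w \<Longrightarrow> path (mirror u) l (mirror w)"
proof -
  assume "path u l w"
  then obtain f where f: "indexed_path G f l" "f 0 = u" "f l = w"
    by (auto simp: path_of_length_iff_indexed_path)
  have "inj_on mirror (f ` {..l})"
    using f(1) by (intro inj_on_subset[OF inj_on_mirror]) (auto simp: indexed_path_iff)
  then have "indexed_path G (mirror \<circ> f) l"
    using f(1) mirror_verts adj_mirror by (auto simp: indexed_path_iff intro: comp_inj_on)
  then show ?thesis unfolding path_of_length_iff_indexed_path using f(2,3) by force
qed

lemma closed_mirror:
  assumes "closed_position_set G T" "T \<subseteq> pverts (cuttlefish n)"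
  shows "closed_position_set G (mirror ` T)"
  unfolding closed_position_set_def
proof (intro ballI allI impI)
  fix x l assume "x \<in> mirror ` T" and l: "may_name G x l"
  then obtain u where u: "u \<in> T" "x = mirror u" by blast
  have "mirror x = u" using u assms(2) by (auto intro: mirror_mirror)
  then have "may_name G u l" using l path_mirror unfolding may_name_def by blast
  then obtain w where "w \<in> T" "path u l w"
    using assms(1) u(1) unfolding closed_position_set_def by blast
  then show "\<exists>w\<in>mirror ` T. path x l w" using path_mirror u(2) by blast
qed

section \<open>Bounds on path lengths\<close>

definition depth_V :: "cf_vertex \<Rightarrow> nat" where
  "depth_V x = (case x of V a \<Rightarrow> a | _ \<Rightarrow> 0)"

definition depth_W :: "cf_vertex \<Rightarrow> nat" where
  "depth_W x = (case x of W a \<Rightarrow> a | _ \<Rightarrow> 0)"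

text \<open>A path goes no deeper into a tail than the deeper of its ends, which leaves it the
  \<open>n\<close> cycle vertices and the tail vertices up to these depths.\<close>

lemma path_length_bound:
  assumes "path x l y"
  shows "l < n + max (depth_V x) (depth_V y) + max (depth_W x) (depth_W y)"
proof -
  obtain f where f: "indexed_path G f l" "f 0 = x" "f l = y"
    using assms by (auto simp: path_of_length_iff_indexed_path)
  let ?a = "max (depth_V x) (depth_V y)" and ?b = "max (depth_W x) (depth_W y)"
  let ?X = "U ` {1..n} \<union> V ` {1..?a} \<union> W ` {1..?b}"
  have V: "f t \<notin> V ` {?a<..}" if "t \<le> l" for t
  \<comment> \<open>The tail beyond depth \<open>?a\<close> hangs on one vertex: the tail vertex of
    that depth, or \<open>U 1\<close> if the depth is 0.\<close>
  proof (rule indexed_path_avoids[OF f(1), where c = "if ?a = 0 then U 1 else V ?a"])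
    fix u w assume "(u, w) \<in> arcs_ends G"
    then have e: "adj u w" by (simp add: adj_def)
    show "w = (if ?a = 0 then U 1 else V ?a)" if "u \<in> V ` {?a<..}" "w \<notin> V ` {?a<..}"
      using e that by (cases w) (auto simp: image_iff)
    show "u = (if ?a = 0 then U 1 else V ?a)" if "u \<notin> V ` {?a<..}" "w \<in> V ` {?a<..}"
      using e that by (cases u) (auto simp: image_iff)
  qed (use f that in \<open>auto simp: depth_V_def\<close>)
  have W: "f t \<notin> W ` {?b<..}" if "t \<le> l" for t
  proof (rule indexed_path_avoids[OF f(1), where c = "if ?b = 0 then U 2 else W ?b"])
    fix u w assume "(u, w) \<in> arcs_ends G"
    then have e: "adj u w" by (simp add: adj_def)
    show "w = (if ?b = 0 then U 2 else W ?b)" if "u \<in> W ` {?b<..}" "w \<notin> W ` {?b<..}"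
      using e that by (cases w) (auto simp: image_iff)
    show "u = (if ?b = 0 then U 2 else W ?b)" if "u \<notin> W ` {?b<..}" "w \<in> W ` {?b<..}"
      using e that by (cases u) (auto simp: image_iff)
  qed (use f that in \<open>auto simp: depth_W_def\<close>)
  have "f t \<in> ?X" if t: "t \<le> l" for t
    using V[OF t] W[OF t] f(1) t by (cases "f t") (auto simp: indexed_path_iff image_iff)
  then have "l < card ?X" by (intro indexed_path_length_less_card[OF f(1)]) auto
  also have "card ?X \<le> card (U ` {1..n}) + card (V ` {1..?a}) + card (W ` {1..?b})"
    by (meson add_le_mono1 card_Un_le le_trans)
  also have "\<dots> \<le> n + ?a + ?b"
    using card_image_le[of "{1..n}" U] card_image_le[of "{1..?a}" V] card_image_le[of "{1..?b}" W]
    by simp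
  finally show ?thesis .
qed

section \<open>Explicit paths along the cycle and the tails\<close>

lemma indexed_pathI:
  assumes "\<And>t. t \<le> l \<Longrightarrow> f t \<in> pverts (cuttlefish n)"
    and "\<And>t. t < l \<Longrightarrow> adj (f t) (f (Suc t))"
    and "\<And>t. t \<le> l \<Longrightarrow> pos (f t) = t"
  shows "indexed_path G f l"
  \<comment> \<open>The left inverse \<open>pos\<close> reads the index off the vertex, which
    reduces injectivity to arithmetic.\<close>
  using assms inj_on_inverseI[of "{..l}" pos f] by (simp add: indexed_path_iff)

lemma path_U_down_V:
  assumes "1 \<le> i" "i \<le> n" "l \<le> i + k - 2"
  shows "path (U i) l (if l < i then U (i - l) else V (Suc l - i))"
proof -
  let ?f = "\<lambda>t. if t < n then U (n - t) else V (Suc t - n)"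
  have "indexed_path G ?f (n + k - 2)"
    \<comment> \<open>The branch for \<open>W\<close> is a default value: the path has no such
      vertex.\<close>
    by (rule indexed_pathI[where pos = "case_cf_vertex (\<lambda>i. n - i) (\<lambda>a. n + a - 1) (\<lambda>_. 0)"])
      (use nk in auto)
  from indexed_path_subpath[OF this, of "n - i" "n - i + l"]
  have p: "path (?f (n - i)) l (?f (n - i + l))" using assms nk by simp
  have e: "?f (n - i) = U i" "?f (n - i + l) = (if l < i then U (i - l) else V (Suc l - i))"
    using assms by auto
  show ?thesis using p unfolding e .
qed

lemma path_U_around:
  assumes "1 \<le> i" "i \<le> n" "l < n"
  shows "path (U i) l (if l < i then U (i - l) else U (i + n - l))"
proof -
  let ?f = "\<lambda>t. if t < i then U (i - t) else U (i + n - t)"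
  have "indexed_path G ?f (n - 1)"
    by (rule indexed_pathI[where
          pos = "case_cf_vertex (\<lambda>j. if j \<le> i then i - j else i + n - j) (\<lambda>_. 0) (\<lambda>_. 0)"])
      (use assms nk in auto)
  from indexed_path_subpath[OF this, of 0 l] show ?thesis using assms by auto
qed

lemma path_W_down_V:
  assumes "1 \<le> a" "a < k" "l \<le> a + k"
  shows "path (W a) l (if l < a then W (a - l) else if l = a then U 2 else if l = Suc a then U 1
    else V (l - Suc a))"
proof -
  \<comment> \<open>\<open>d\<close> is the distance from \<open>W a\<close> to its leaf, hence the
    index at which the subpath starts; writing \<open>k\<close> in terms of \<open>d\<close> avoids
    truncated subtraction.\<close>
  obtain d where d: "k = Suc (a + d)" using less_imp_Suc_add[OF assms(2)] by blast
  let ?f = "\<lambda>t. if Suc t < k then W (k - Suc t) else if Suc t = k then U 2 else if t = k then U 1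
    else V (t - k)"
  have "indexed_path G ?f (2 * k - 1)"
    by (rule indexed_pathI[where
          pos = "case_cf_vertex (\<lambda>j. if j = 2 then k - 1 else k) (\<lambda>b. k + b) (\<lambda>b. k - Suc b)"])
      (use nk in auto)
  from indexed_path_subpath[OF this, of d "d + l"]
  have p: "path (?f d) l (?f (d + l))" using assms nk by (simp add: d)
  have e: "?f d = W a" "?f (d + l) = (if l < a then W (a - l) else if l = a then U 2
      else if l = Suc a then U 1 else V (l - Suc a))"
    using assms by (auto simp: d)
  show ?thesis using p unfolding e .
qed

lemma path_W_down_U:
  assumes "1 \<le> a" "a < k" "a + 2 \<le> l" "l < a + n"
  shows "path (W a) l (U (a + n + 2 - l))"
proof -
  obtain d where d: "k = Suc (a + d)" using less_imp_Suc_add[OF assms(2)] by blast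
  let ?f = "\<lambda>t. if Suc t < k then W (k - Suc t) else if Suc t = k then U 2 else if t = k then U 1
    else U (n + k + 1 - t)"
  have "indexed_path G ?f (n + k - 2)"
    by (rule indexed_pathI[where
          pos = "case_cf_vertex (\<lambda>j. if j = 2 then k - 1 else if j = 1 then k else n + k + 1 - j)
            (\<lambda>_. 0) (\<lambda>b. k - Suc b)"])
      (use nk in auto)
  from indexed_path_subpath[OF this, of d "d + l"]
  have p: "path (?f d) l (?f (d + l))" using assms nk by (simp add: d)
  have e: "?f d = W a" "?f (d + l) = U (a + n + 2 - l)"
    using assms by (auto simp: d)
  show ?thesis using p unfolding e .
qed

lemma path_V_up_U:
  assumes "1 \<le> a" "a < k" "l < a + n"
  shows "path (V a) l (if l < a then V (a - l) else U (Suc l - a))"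
proof -
  obtain d where d: "k = Suc (a + d)" using less_imp_Suc_add[OF assms(2)] by blast
  let ?f = "\<lambda>t. if Suc t < k then V (k - Suc t) else U (t + 2 - k)"
  have "indexed_path G ?f (n + k - 2)"
    by (rule indexed_pathI[where
          pos = "case_cf_vertex (\<lambda>j. j + k - 2) (\<lambda>b. k - Suc b) (\<lambda>_. 0)"])
      (use nk in auto)
  from indexed_path_subpath[OF this, of d "d + l"]
  have p: "path (?f d) l (?f (d + l))" using assms nk by (simp add: d)
  have e: "?f d = V a" "?f (d + l) = (if l < a then V (a - l) else U (Suc l - a))"
    using assms by (auto simp: d)
  show ?thesis using p unfolding e .
qed

text \<open>A Hamiltonian path: from the leaf \<open>V (k - 1)\<close> to \<open>U 1\<close>, down
  the cycle from \<open>U n\<close> to \<open>U 2\<close>, and out to the leaf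
  \<open>W (k - 1)\<close>.\<close>

definition spine :: "nat \<Rightarrow> cf_vertex" where
  "spine t = (if Suc t < k then V (k - Suc t) else if Suc t = k then U 1
    else if Suc t < n + k then U (n + k - t) else W (t + 2 - (n + k)))"

lemma indexed_path_spine: "indexed_path G spine (n + 2 * k - 3)"
  by (rule indexed_pathI[where
        pos = "case_cf_vertex (\<lambda>j. if j = 1 then k - 1 else n + k - j) (\<lambda>b. k - Suc b)
          (\<lambda>b. b + n + k - 2)"])
    (use nk in \<open>auto simp: spine_def\<close>)

lemma path_V_around_U:
  assumes "1 \<le> a" "a < k" "a < l" "l < a + n"
  shows "path (V a) l (U (a + n + 1 - l))"
proof -
  obtain d where d: "k = Suc (a + d)" using less_imp_Suc_add[OF assms(2)] by blast
  from indexed_path_subpath[OF indexed_path_spine, of d "d + l"]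
  have p: "path (spine d) l (spine (d + l))" using assms nk by (simp add: d)
  have "spine d = V a" "spine (d + l) = U (a + n + 1 - l)"
    using assms unfolding spine_def by (auto simp: d)
  then show ?thesis using p by simp
qed

lemma path_V_spine_W:
  assumes "1 \<le> a" "a < k"
  shows "path (V a) (a + n + k - 2) (W (k - 1))"
proof -
  obtain d where d: "k = Suc (a + d)" using less_imp_Suc_add[OF assms(2)] by blast
  from indexed_path_subpath[OF indexed_path_spine, of d "n + 2 * k - 3"]
  have "path (spine d) (n + 2 * k - 3 - d) (spine (n + 2 * k - 3))" using d by simp
  moreover have "spine d = V a" using assms(1) unfolding spine_def by (simp add: d)
  moreover have "spine (n + 2 * k - 3) = W (k - 1)" using nk by (auto simp: spine_def)
  moreover have "n + 2 * k - 3 - d = a + n + k - 2" using d nk by simp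
  ultimately show ?thesis by simp
qed

lemma path_U1_spine_W: "path (U 1) n (W 1)"
proof -
  from indexed_path_subpath[OF indexed_path_spine, of "k - 1" "n + k - 1"]
  have "path (spine (k - 1)) n (spine (n + k - 1))" using nk by simp
  moreover have "spine (k - 1) = U 1" "spine (n + k - 1) = W 1"
    using nk by (auto simp: spine_def)
  ultimately show ?thesis by simp
qed

section \<open>A closed set with \<open>n + k - 1\<close> vertices\<close>

definition low_set :: "cf_vertex set" where
  "low_set = U ` {1..n + 1 - k} \<union> V ` {1..<k} \<union> W ` {1..<k}"

lemma low_set_simps [simp]:
  "U i \<in> low_set \<longleftrightarrow> 1 \<le> i \<and> i \<le> n + 1 - k"
  "V i \<in> low_set \<longleftrightarrow> 1 \<le> i \<and> i < k"
  "W i \<in> low_set \<longleftrightarrow> 1 \<le> i \<and> i < k"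
  by (auto simp: low_set_def)

lemma low_set_verts: "low_set \<subseteq> pverts (cuttlefish n)"
  using nk by (auto simp: low_set_def)

lemma card_low_set: "card low_set = n + k - 1"
proof -
  have "card low_set = card (U ` {1..n + 1 - k}) + card (V ` {1..<k}) + card (W ` {1..<k})"
    unfolding low_set_def by (subst card_Un_disjoint; (auto simp: card_Un_disjoint)?)+
  also have "\<dots> = n + k - 1" using nk by (simp add: card_image inj_on_def)
  finally show ?thesis .
qed

lemma in_low_set_if_beyond_U:
  assumes "path u l w" "\<And>i. w \<noteq> U i"
  shows "w \<in> low_set"
  using path_of_length_target_in_verts[OF assms(1)] assms(2) by (cases w) auto

lemma path_to_U_bound: "path u l (U i) \<Longrightarrow> l < n + depth_V u + depth_W u"
  by (drule path_length_bound) (simp add: depth_V_def depth_W_def)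

text \<open>The missing arc has \<open>k - 1\<close> vertices, as many as the \<open>V\<close> tail,
  so a walk down through \<open>U 1\<close> can end in that tail exactly while it would otherwise
  end on the arc.\<close>

lemma closed_low_set: "closed_position_set G low_set"
  unfolding closed_position_set_def
proof (intro ballI allI impI)
  fix u l assume u: "u \<in> low_set" and "may_name G u l"
  then obtain w where w: "path u l w" by (auto simp: may_name_def)
  show "\<exists>w\<in>low_set. path u l w"
  \<comment> \<open>Longer names cannot end on the cycle, and all tail vertices are in the
    set.\<close>
  proof (cases "l < n + depth_V u + depth_W u")
    case False
    then have "\<And>i. w \<noteq> U i" using path_to_U_bound w by blast
    then show ?thesis using in_low_set_if_beyond_U[OF w] w by blast
  next
    case l: True
    show ?thesis
    proof (cases u)
      case (U i)
      then have i: "1 \<le> i" "i \<le> n + 1 - k" "i \<le> n" "l < n"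
        using u l nk by (auto simp: depth_V_def depth_W_def)
      show ?thesis
      proof (cases "l \<le> i + k - 2")
        case True
        have "(if l < i then U (i - l) else V (Suc l - i)) \<in> low_set" using i True nk by auto
        then show ?thesis using path_U_down_V[OF i(1,3) True] U by blast
      next
        case False
        have "(if l < i then U (i - l) else U (i + n - l)) \<in> low_set" using i False nk by auto
        then show ?thesis using path_U_around[OF i(1,3,4)] U by blast
      qed
    next
      case (V a)
      then have a: "1 \<le> a" "a < k" "l < a + n"
        using u l nk by (auto simp: depth_V_def depth_W_def)
      show ?thesis
      \<comment> \<open>The walk up the cycle reaches \<open>U (n + 1 - k)\<close>, the last cycle
        vertex of the set, at this length; longer names go round the other way.\<close>
      proof (cases "l \<le> a + n - k")
        case True
        have "(if l < a then V (a - l) else U (Suc l - a)) \<in> low_set" using a True nk by auto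
        then show ?thesis using path_V_up_U[OF a] V by blast
      next
        case False
        have "U (a + n + 1 - l) \<in> low_set" using a False nk by auto
        moreover have "a < l" using a False nk by linarith
        ultimately show ?thesis using path_V_around_U[OF a(1,2) _ a(3)] V by blast
      qed
    next
      case (W a)
      then have a: "1 \<le> a" "a < k" "l < a + n"
        using u l nk by (auto simp: depth_V_def depth_W_def)
      show ?thesis
      proof (cases "l \<le> a + k")
        case True
        have "(if l < a then W (a - l) else if l = a then U 2 else if l = Suc a then U 1
          else V (l - Suc a)) \<in> low_set" using a True nk by auto
        then show ?thesis using path_W_down_V[OF a(1,2) True] W by blast
      next
        case False
        have "U (a + n + 2 - l) \<in> low_set" using a False nk by auto
        moreover have "a + 2 \<le> l" using False nk by linarith
        ultimately show ?thesis using path_W_down_U[OF a(1,2) _ a(3)] W by blast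
      qed
    qed
  qed
qed

section \<open>Paths starting at a leaf\<close>

lemma forced_tail:
  assumes f: "indexed_path G f l" "f 0 = V (k - 1)" and t: "t \<le> l"
  shows "t < k - 1 \<Longrightarrow> f t = V (k - 1 - t)" "t = k - 1 \<Longrightarrow> f t = U 1"
proof -
  have adj: "adj (f s) (f (Suc s))" if "Suc s \<le> l" for s using f that by (simp add: indexed_path_iff)
  have neq: "f (Suc (Suc s)) \<noteq> f s" if "Suc (Suc s) \<le> l" for s
    using f that by (auto simp: indexed_path_iff dest: inj_onD)
  \<comment> \<open>One of the two neighbours of an inner tail vertex has just been left, so the
    induction needs the two preceding positions.\<close>
  have V: "t \<le> l \<Longrightarrow> t < k - 1 \<Longrightarrow> f t = V (k - 1 - t)" for t
  proof (induction t rule: less_induct)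
    case (less t)
    consider "t = 0" | "t = 1" | s where "t = Suc (Suc s)" by (cases t; cases "t - 1") auto
    then show ?case
    proof cases
      case 1 then show ?thesis using f by simp
    next
      case 2
      then show ?thesis using adj[of 0] f(2) less nk by (cases "f 1") auto
    next
      case 3
      then have "f s = V (k - 1 - s)" "f (Suc s) = V (k - 1 - Suc s)" using less by auto
      then show ?thesis using adj[of "Suc s"] neq[of s] 3 less(2,3) by (cases "f t") auto
    qed
  qed
  show "t < k - 1 \<Longrightarrow> f t = V (k - 1 - t)" using V t by blast
  show "f t = U 1" if "t = k - 1"
  proof -
    define s where "s = k - 3"
    have s: "k - 1 = Suc (Suc s)" using nk by (simp add: s_def)
    have "f s = V 2" "f (Suc s) = V 1" using V[of s] V[of "Suc s"] s that t by auto
    then show ?thesis using adj[of "Suc s"] neq[of s] s that t by (cases "f t") auto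
  qed
qed

lemma path_leaf_short:
  assumes "path (V (k - 1)) l w" "l < k"
  shows "w = (if l < k - 1 then V (k - 1 - l) else U 1)"
proof -
  obtain f where f: "indexed_path G f l" "f 0 = V (k - 1)" "f l = w"
    using assms by (auto simp: path_of_length_iff_indexed_path)
  have "l < k - 1 \<or> l = k - 1" using assms(2) by auto
  then show ?thesis using forced_tail[OF f(1,2) le_refl] f(3) by auto
qed

text \<open>From \<open>U 1\<close> there remain \<open>j\<close> steps, down or up the cycle. The
  descent ends at \<open>U 3\<close> at the latest, before it can turn at \<open>U 2\<close>; an
  ascent that turns into the \<open>W\<close> tail is stuck too early because
  \<open>k < j\<close>.\<close>

lemma path_leaf_long:
  assumes "path (V (k - 1)) (k - 1 + j) w" "k < j" "j \<le> n - 2"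
  shows "w = U (Suc j) \<or> w = U (n + 1 - j)"
proof -
  let ?l = "k - 1 + j"
  obtain f where f: "indexed_path G f ?l" "f 0 = V (k - 1)" "f ?l = w"
    using assms by (auto simp: path_of_length_iff_indexed_path)
  define g where "g s = f (k - 1 + s)" for s
  have adj: "adj (g s) (g (Suc s))" if "Suc s \<le> j" for s
    using f that by (simp add: indexed_path_iff g_def)
  have inj: "g s \<noteq> g t" if "s < t" "t \<le> j" for s t
  proof -
    have "k - 1 + s \<in> {..?l}" "k - 1 + t \<in> {..?l}" "k - 1 + s \<noteq> k - 1 + t" using that by auto
    then show ?thesis using f(1) unfolding indexed_path_iff g_def inj_on_def by blast
  qed
  have g0: "g 0 = U 1" using forced_tail(2)[OF f(1,2), of "k - 1"] by (simp add: g_def)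
  have "f (k - 2) = V 1" using forced_tail(1)[OF f(1,2), of "k - 2"] nk by simp
  moreover have "f (k - 2) \<noteq> f k"
    using f(1) nk assms(2) by (auto simp: indexed_path_iff dest: inj_onD)
  ultimately have "g 1 \<noteq> V 1" using nk by (simp add: g_def)
  then consider "g 1 = U n" | "g 1 = U 2"
    using adj[of 0] g0 assms(2) by (cases "g 1") auto
  then show ?thesis
  proof cases
    case 1
    have "g (Suc s) = U (n - s)" if "Suc s \<le> j" for s
      using that
    proof (induction s rule: less_induct)
      case (less s)
      consider "s = 0" | "s = 1" | r where "s = Suc (Suc r)" by (cases s; cases "s - 1") auto
      then show ?case
      proof cases
        case 1 then show ?thesis using \<open>g 1 = U n\<close> by simp
      next
        case 2
        then show ?thesis
          using adj[of 1] inj[of 0 2] g0 \<open>g 1 = U n\<close> less(2) n_ge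
          by (cases "g 2") (auto simp: numeral_2_eq_2)
      next
        case 3
        then have "g (Suc r) = U (n - r)" "g s = U (n - Suc r)" using less by auto
        then show ?thesis using adj[of s] inj[of "Suc r" "Suc s"] 3 less(2) assms(3)
          by (cases "g (Suc s)") auto
      qed
    qed
    from this[of "j - 1"] show ?thesis using assms f(3) by (auto simp: g_def)
  next
    case 2
    have "g 2 \<noteq> U 1" using inj[of 0 2] g0 assms(2) nk by auto
    then consider "g 2 = U 3" | "g 2 = W 1"
      using adj[of 1] 2 assms(2) nk n_ge by (cases "g 2") (auto simp: numeral_2_eq_2)
    then show ?thesis
    proof cases
      case 1
      have "g (Suc s) = U (Suc (Suc s))" if "Suc s \<le> j" for s
        using that
      proof (induction s rule: less_induct)
        case (less s)
        consider "s = 0" | "s = 1" | r where "s = Suc (Suc r)" by (cases s; cases "s - 1") auto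
        then show ?case
        proof cases
          case 1 then show ?thesis using \<open>g 1 = U 2\<close> by (simp add: numeral_2_eq_2)
        next
          case 2 then show ?thesis using \<open>g 2 = U 3\<close> by (simp add: numeral_2_eq_2 numeral_3_eq_3)
        next
          case 3
          then have "g (Suc r) = U (Suc (Suc r))" "g s = U (Suc s)" using less by auto
          then show ?thesis using adj[of s] inj[of "Suc r" "Suc s"] 3 less(2) assms(3)
            by (cases "g (Suc s)") auto
        qed
      qed
      from this[of "j - 1"] show ?thesis using assms f(3) by (auto simp: g_def)
    next
      case 2
      \<comment> \<open>Step \<open>k\<close> reaches the leaf \<open>W (k - 1)\<close>, whose only
        neighbour is already used, while another step is due.\<close>
      have "g (Suc s) = W s" if "1 \<le> s" "s < k" for s
        using that
      proof (induction s rule: less_induct)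
        case (less s)
        consider "s = 1" | "s = 2" | r where "s = Suc (Suc r)" "1 \<le> r"
          using less(2) by (cases s; cases "s - 1"; cases "s - 2") auto
        then show ?case
        proof cases
          case 1 then show ?thesis using \<open>g 2 = W 1\<close> by (simp add: numeral_2_eq_2)
        next
          case 2
          have "g 3 \<noteq> U 2" using inj[of 1 3] \<open>g 1 = U 2\<close> assms(2) nk by auto
          then show ?thesis using 2 adj[of 2] \<open>g 2 = W 1\<close> assms(2) nk
            by (cases "g 3") (auto simp: numeral_3_eq_3 numeral_2_eq_2)
        next
          case 3
          then have "g (Suc r) = W r" "g s = W (Suc r)" using less by auto
          then show ?thesis using adj[of s] inj[of "Suc r" "Suc s"] 3 less(3) assms(2)
            by (cases "g (Suc s)") auto
        qed
      qed
      from this[of "k - 1"] this[of "k - 2"] have "g k = W (k - 1)" "g (k - 1) = W (k - 2)"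
        using nk by (auto simp: Suc_diff_Suc numeral_2_eq_2)
      then have False using adj[of k] inj[of "k - 1" "Suc k"] assms(2) nk
        by (cases "g (Suc k)") auto
      then show ?thesis ..
    qed
  qed
qed

section \<open>Lower bound for closed sets\<close>

lemma closed_answer:
  assumes "closed_position_set G T" "u \<in> T" "0 < l" "path u l w"
  shows "\<exists>w'\<in>T. path u l w'"
  using assms unfolding closed_position_set_def may_name_def by blast

lemma in_mirror_image_iff:
  assumes "T \<subseteq> pverts (cuttlefish n)" "x \<in> pverts (cuttlefish n)"
  shows "x \<in> mirror ` T \<longleftrightarrow> mirror x \<in> T"
  using assms by (metis imageE imageI mirror_mirror subsetD)

lemma mirror_image_verts: "T \<subseteq> pverts (cuttlefish n) \<Longrightarrow> mirror ` T \<subseteq> pverts (cuttlefish n)"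
  using mirror_verts by blast

lemma closed_meets_tails:
  assumes T: "closed_position_set G T" "T \<subseteq> pverts (cuttlefish n)" "T \<noteq> {}"
  shows "\<exists>a. V a \<in> T \<or> W a \<in> T"
proof (rule ccontr)
  assume no: "\<nexists>a. V a \<in> T \<or> W a \<in> T"
  \<comment> \<open>A path of length \<open>n\<close> between cycle vertices would be too long, so a
    nameable \<open>n\<close> would force an answer on a tail.\<close>
  have far: "\<not> path (U x) n w" if x: "U x \<in> T" for x w
  proof
    assume "path (U x) n w"
    then obtain w' where w': "w' \<in> T" "path (U x) n w'"
      using closed_answer[OF T(1) x, of n w] n_ge by auto
    obtain j where "w' = U j" using w'(1) no by (cases w') auto
    then show False using path_to_U_bound w'(2) by (force simp: depth_V_def depth_W_def)
  qed
  have high: "U x \<notin> T" if "n + 2 \<le> x + k" "x \<le> n" for x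
  proof -
    have "1 \<le> x" "n \<le> x + k - 2" using that nk by auto
    then show ?thesis using far path_U_down_V[of x n] that(2) by blast
  qed
  \<comment> \<open>The mirror image of \<open>high\<close>.\<close>
  have low: "U x \<notin> T" if "3 \<le> x" "x \<le> Suc k" for x
  proof
    assume x: "U x \<in> T"
    have "path (U (n + 3 - x)) n (V (x - 2))"
      using path_U_down_V[of "n + 3 - x" n] that nk by (auto split: if_splits)
    moreover have "mirror (U (n + 3 - x)) = U x" using that nk by auto
    ultimately show False using far[OF x] path_mirror by metis
  qed
  have one: "U 1 \<notin> T" using far[of 1] path_U1_spine_W by blast
  have two: "U 2 \<notin> T" using far[of 2] path_mirror[OF path_U1_spine_W] by auto
  obtain x where x: "U x \<in> T" using T(3) no by (metis cf_vertex.exhaust ex_in_conv)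
  have xn: "1 \<le> x" "x \<le> n" using x T(2) by auto
  have "x \<noteq> 1" "x \<noteq> 2" using x one two by auto
  moreover have "\<not> (3 \<le> x \<and> x \<le> Suc k)" using low x by blast
  moreover have "\<not> n + 2 \<le> x + k" using high x xn by blast
  \<comment> \<open>This middle vertex is left over only for odd \<open>n\<close>; naming 1 moves
    the token to a neighbour covered by \<open>low\<close> or \<open>high\<close>.\<close>
  ultimately have xk: "x = k + 2" using xn nk by linarith
  have "adj (U x) (U (Suc x))" using xk nk by simp
  then obtain w where w: "w \<in> T" "adj (U x) w"
    using closed_answer[OF T(1) x, of 1 "U (Suc x)"] path_edge by auto
  then obtain y where "w = U y" using no by (cases w) auto
  then have "y = Suc k \<or> y = k + 3" using w(2) xk nk by auto
  then show False using w(1) \<open>w = U y\<close> low[of y] high[of y] nk by auto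
qed

text \<open>\<open>a + n + k - 2\<close> is the length of a longest path from \<open>V a\<close>,
  and \<open>path_length_bound\<close> leaves the opposite leaf as its only end.\<close>

lemma closed_contains_opposite_leaf:
  assumes T: "closed_position_set G T" "T \<subseteq> pverts (cuttlefish n)" and a: "V a \<in> T"
  shows "W (k - 1) \<in> T"
proof -
  have ak: "1 \<le> a" "a < k" using a T(2) by auto
  obtain w where w: "w \<in> T" "path (V a) (a + n + k - 2) w"
    using closed_answer[OF T(1) a _ path_V_spine_W[OF ak]] nk by auto
  have l: "a + n + k - 2 < n + max a (depth_V w) + depth_W w"
    using path_length_bound[OF w(2)] by (simp add: depth_V_def depth_W_def)
  have "w \<in> pverts (cuttlefish n)" using w(1) T(2) by blast
  then have "w = W (k - 1)"
    using l nk ak by (cases w) (auto simp: depth_V_def depth_W_def)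
  then show ?thesis using w(1) by simp
qed

lemma closed_contains_tail:
  assumes T: "closed_position_set G T" and leaf: "V (k - 1) \<in> T"
  shows "1 \<le> b \<Longrightarrow> b < k \<Longrightarrow> V b \<in> T" "U 1 \<in> T"
proof -
  have target: "(if l < k - 1 then V (k - 1 - l) else U 1) \<in> T" if l: "0 < l" "l < k" for l
  proof -
    have "1 \<le> k - 1" "k - 1 < k" "l < k - 1 + n" using l nk by auto
    then obtain w where "w \<in> T" "path (V (k - 1)) l w"
      using closed_answer[OF T leaf l(1) path_V_up_U] by blast
    then show ?thesis using path_leaf_short l(2) by auto
  qed
  show "V b \<in> T" if "1 \<le> b" "b < k"
  proof (cases "b = k - 1")
    case False
    then have "(if k - 1 - b < k - 1 then V (k - 1 - (k - 1 - b)) else U 1) = V b"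
      using that by auto
    then show ?thesis using target[of "k - 1 - b"] that False by auto
  qed (use leaf in simp)
  show "U 1 \<in> T" using target[of "k - 1"] nk by simp
qed

text \<open>The name \<open>k + i - 2\<close> leaves \<open>i - 1\<close> steps from
  \<open>U 1\<close>; the range of \<open>i\<close> is the one \<open>path_leaf_long\<close>
  requires of \<open>i - 1\<close>.\<close>

lemma closed_leaf_pairs:
  assumes T: "closed_position_set G T" and leaf: "V (k - 1) \<in> T"
    and i: "k + 2 \<le> i" "i \<le> n - 1"
  shows "U i \<in> T \<or> U (n + 2 - i) \<in> T"
proof -
  let ?j = "i - 1"
  have j: "1 \<le> k - 1" "k - 1 < k" "k - 1 + ?j < k - 1 + n" "0 < k - 1 + ?j" using i nk by auto
  obtain w where w: "w \<in> T" "path (V (k - 1)) (k - 1 + ?j) w"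
    using closed_answer[OF T leaf j(4) path_V_up_U[OF j(1-3)]] by blast
  have "w = U (Suc ?j) \<or> w = U (n + 1 - ?j)"
    using path_leaf_long[OF w(2)] i nk by auto
  moreover have "Suc ?j = i" "n + 1 - ?j = n + 2 - i" using i by auto
  ultimately show ?thesis using w(1) by auto
qed

lemma card_closed_ge:
  assumes T: "closed_position_set G T" "T \<subseteq> pverts (cuttlefish n)" "T \<noteq> {}"
  shows "n + k - 1 \<le> card T"
proof -
  let ?M = "mirror ` T"
  have M: "closed_position_set G ?M" "?M \<subseteq> pverts (cuttlefish n)"
    using closed_mirror T mirror_image_verts by auto
  have mem: "x \<in> ?M \<longleftrightarrow> mirror x \<in> T" if "x \<in> pverts (cuttlefish n)" for x
    using in_mirror_image_iff T(2) that by blast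
  have WV: "V (k - 1) \<in> T" if "W a \<in> T" for a
  proof -
    have "V a \<in> ?M" using that mirror_simps(2) image_eqI by metis
    then show ?thesis using closed_contains_opposite_leaf[OF M] mem[of "W (k - 1)"] nk by auto
  qed
  have leafV: "V (k - 1) \<in> T" and leafW: "W (k - 1) \<in> T"
    using closed_meets_tails[OF T] WV closed_contains_opposite_leaf[OF T(1,2)] by blast+
  have leafM: "V (k - 1) \<in> ?M" using mem[of "V (k - 1)"] leafW nk by auto
  \<comment> \<open>Both tails, \<open>U 1\<close> and \<open>U 2\<close> account for
    \<open>2 * k\<close> vertices, so \<open>R\<close> has to supply \<open>n - k - 1\<close>
    more.\<close>
  define R where "R = {i. 3 \<le> i \<and> i \<le> n \<and> U i \<in> T}"
  have fR: "finite R" unfolding R_def by simp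
  have inR: "3 \<le> i" if "i \<in> R" for i using that by (simp add: R_def)
  have A: "i \<in> R \<or> n + 2 - i \<in> R" if "k + 2 \<le> i" "i \<le> n - 1" for i
    using closed_leaf_pairs[OF T(1) leafV that] that nk by (auto simp: R_def)
  \<comment> \<open>The pairs of the mirror image, taken at \<open>i - 1\<close>: reflecting
    \<open>x\<close> to \<open>n + 3 - x\<close> turns the sum \<open>n + 2\<close> into
    \<open>n + 4\<close>.\<close>
  have B: "i \<in> R \<or> n + 4 - i \<in> R" if "k + 3 \<le> i" "i \<le> n" for i
  proof -
    have "U (i - 1) \<in> ?M \<or> U (n + 2 - (i - 1)) \<in> ?M"
      by (rule closed_leaf_pairs[OF M(1) leafM]) (use that nk in auto)
    moreover have "U (i - 1) \<in> pverts (cuttlefish n)"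
      "U (n + 2 - (i - 1)) \<in> pverts (cuttlefish n)" using that nk by auto
    ultimately have "mirror (U (i - 1)) \<in> T \<or> mirror (U (n + 2 - (i - 1))) \<in> T"
      using mem by blast
    moreover have "\<not> i - 1 \<le> 2" "\<not> n + 2 - (i - 1) \<le> 2" using that nk by auto
    ultimately have "U (n + 3 - (i - 1)) \<in> T \<or> U (n + 3 - (n + 2 - (i - 1))) \<in> T"
      unfolding mirror_simps by simp
    moreover have "n + 3 - (i - 1) = n + 4 - i" "n + 3 - (n + 2 - (i - 1)) = i" using that nk by auto
    ultimately show ?thesis using that nk by (auto simp: R_def)
  qed
  have card_R: "n - k - 1 \<le> card R"
  proof -
    \<comment> \<open>Each family has \<open>n - k - 2\<close> pairs, so it suffices that one family
      is still met after removing some \<open>x\<close> from \<open>R\<close>.\<close>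
    have extra: "n - k - 1 \<le> card R" if "x \<in> R" "n - k - 2 \<le> card (R - {x})" for x
    proof -
      have "card R = Suc (card (R - {x}))" using card.remove[OF fR that(1)] by simp
      then show ?thesis using that(2) by simp
    qed
    consider "n \<in> R" | "3 \<in> R" | "n \<notin> R" "3 \<notin> R" by blast
    then show ?thesis
    proof cases
      case 1
      \<comment> \<open>No pair of the first family contains \<open>n\<close>.\<close>
      have "i \<in> R - {n} \<or> n + 2 - i \<in> R - {n}" if "k + 2 \<le> i" "i \<le> n - 1" for i
        using A[OF that] that nk by auto
      then have "Suc (n - 1) - (k + 2) \<le> card (R - {n})"
        using fR nk by (intro card_ge_pairs[where c = "n + 2"]) auto
      then have "n - k - 2 \<le> card (R - {n})" by simp
      then show ?thesis using extra 1 by blast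
    next
      case 2
      \<comment> \<open>No pair of the second family contains 3.\<close>
      have "i \<in> R - {3} \<or> n + 4 - i \<in> R - {3}" if "k + 3 \<le> i" "i \<le> n" for i
        using B[OF that] that nk by auto
      then have "Suc (n) - (k + 3) \<le> card (R - {3})"
        using fR nk by (intro card_ge_pairs[where c = "n + 4"]) auto
      then have "n - k - 2 \<le> card (R - {3})" by simp
      then show ?thesis using extra 2 by blast
    next
      case 3
      have n1: "n - 1 \<in> R" using A[of "n - 1"] 3 nk by (auto simp: numeral_3_eq_3)
      have "4 \<in> R" using B[of n] 3 nk by auto
      then have "U 4 \<in> T" by (simp add: R_def)
      moreover have "adj (U 4) (U 5)" using n_ge by simp
      ultimately obtain w where w: "w \<in> T" "adj (U 4) w"
        using closed_answer[OF T(1), of "U 4" 1 "U 5"] path_edge by auto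
      have "w \<noteq> U 3" using 3(2) w(1) n_ge by (auto simp: R_def)
      then have "w = U 5" using w(2) n_ge by (cases w) auto
      then have 5: "5 \<in> R" using w(1) n_ge by (simp add: R_def)
      \<comment> \<open>Only the pair of \<open>n - 1\<close> contains 5, and \<open>n - 1\<close>
        itself is in \<open>R\<close>.\<close>
      have "i \<in> R - {5} \<or> n + 4 - i \<in> R - {5}" if "k + 3 \<le> i" "i \<le> n" for i
        using B[OF that] that nk n1 by (cases "i = n - 1") auto
      then have "Suc (n) - (k + 3) \<le> card (R - {5})"
        using fR nk by (intro card_ge_pairs[where c = "n + 4"]) auto
      then have "n - k - 2 \<le> card (R - {5})" by simp
      then show ?thesis using extra 5 by blast
    qed
  qed
  let ?X = "V ` {1..<k} \<union> W ` {1..<k} \<union> U ` ({1, 2} \<union> R)"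
  have W: "W b \<in> T" if "1 \<le> b" "b < k" for b
    using closed_contains_tail(1)[OF M(1) leafM that] mem[of "V b"] that by auto
  have "U 2 \<in> T" using closed_contains_tail(2)[OF M(1) leafM] mem[of "U 1"] n_ge by auto
  then have "?X \<subseteq> T"
    using closed_contains_tail[OF T(1) leafV] W by (auto simp: R_def)
  moreover have "finite T" using T(2) finite_verts finite_subset by blast
  ultimately have "card ?X \<le> card T" by (rule card_mono[rotated])
  moreover have "card ?X = card (V ` {1..<k}) + card (W ` {1..<k}) + card (U ` ({1, 2} \<union> R))"
    using fR by (subst card_Un_disjoint; (auto simp: card_Un_disjoint)?)+
  moreover have "card ({1, 2} \<union> R) = 2 + card R"
  proof -
    have "1 \<notin> R" "2 \<notin> R" using inR[of 1] inR[of 2] by auto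
    then show ?thesis using fR by simp
  qed
  moreover have "card (V ` {1..<k}) = k - 1" "card (W ` {1..<k}) = k - 1"
    "card (U ` ({1, 2} \<union> R)) = card ({1, 2} \<union> R)"
    by (subst card_image; simp add: inj_on_def)+
  ultimately have "k - 1 + (k - 1) + (2 + card R) \<le> card T" by linarith
  then show ?thesis using card_R nk by linarith
qed

theorem f_p_cuttlefish:
  assumes "v \<in> pverts (cuttlefish n)"
  shows "f_p G v = n + k - 1"
proof -
  have mobile: "\<exists>l. may_name G u l" if "u \<in> verts G" for u
  proof -
    have "\<exists>w. adj u w"
    proof (cases u)
      case (U i)
      then show ?thesis
        using that n_ge by (intro exI[of _ "U (if i = n then 1 else Suc i)"]) auto
    next
      case (V a)
      then show ?thesis
        using that n_ge nk by (intro exI[of _ "if a = 1 then U 1 else V (a - 1)"]) auto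
    next
      case (W a)
      then show ?thesis
        using that n_ge nk by (intro exI[of _ "if a = 1 then U 2 else W (a - 1)"]) auto
    qed
    then show ?thesis using path_edge unfolding may_name_def by (metis zero_less_one)
  qed
  have game_value: "f_p G v = card S" if "closed_position_set G S" "v \<in> S" "S \<subseteq> pverts (cuttlefish n)"
      "card S = n + k - 1" for S
    by (rule f_p_eq_card_closed_set) (use that mobile card_closed_ge finite_verts in auto)
  show ?thesis
  proof (cases "v \<in> low_set")
    case True
    then show ?thesis using game_value[OF closed_low_set True low_set_verts] card_low_set by simp
  next
    case False
    \<comment> \<open>Here \<open>v\<close> is some \<open>U i\<close> with
      \<open>i > n + 1 - k\<close>; its mirror image has index at most \<open>k + 1\<close>, which
      is at most \<open>n + 1 - k\<close>.\<close>
    have "mirror v \<in> low_set" using assms False nk by (cases v) auto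
    then have "v \<in> mirror ` low_set" using in_mirror_image_iff[OF low_set_verts assms] by simp
    moreover have "card (mirror ` low_set) = n + k - 1"
      using card_low_set card_image[OF inj_on_subset[OF inj_on_mirror low_set_verts]] by simp
    ultimately show ?thesis
      using game_value[OF closed_mirror[OF closed_low_set low_set_verts] _
          mirror_image_verts[OF low_set_verts]] by simp
  qed
qed

end

theorem theorem5p1:
  fixes n :: nat and v :: cf_vertex
  assumes "n \<ge> 10"
    and "v \<in> verts (with_proj (cuttlefish n))"
  shows "(odd n \<longrightarrow> f_p (with_proj (cuttlefish n)) v = 3 * (n div 2)) \<and>
         (even n \<longrightarrow> f_p (with_proj (cuttlefish n)) v = 3 * n div 2 - 1)"
proof -
  interpret large_cuttlefish n "n div 2"
    using assms(1) by unfold_locales auto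
  have "f_p (with_proj (cuttlefish n)) v = n + n div 2 - 1"
    using f_p_cuttlefish assms(2) by simp
  then show ?thesis by (auto elim!: oddE evenE)
qed

end
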